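(* Let $G$ be a graph and $t$ a positive integer. If $G$ is $t$-unique, then $G$ is $s$-unique for all integers $s$ such that $t\le s\le \mathrm{td}(G)$.
   Context: Graphs are finite and simple. A $k$-ranking of a graph $G$ is a labeling of $V(G)$ with values from $\{1,\dots,k\}$ such that every path joining two distinct vertices with the same label contains a vertex having a larger label. The tree-depth $\mathrm{td}(G)$ is the smallest $k$ for which $G$ has a $k$-ranking. A ranking of $G$ is optimal if it is a $\mathrm{td}(G)$-ranking. A vertex $v$ of $G$ is $t$-unique if there exists an optimal ranking of $G$ in which $v$ is the unique vertex with label $t$. The graph $G$ is $t$-unique if each of its vertices is $t$-unique. *)

theory Defs
  imports "Graph_Theory.Graph_Theory"
begin

text \<open>
  Finite simple graphs are the instances of the locale \<^locale>\<open>graph\<close>: finite, loop-free digraphs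
  without parallel arcs whose arc relation is symmetric; the graph without vertices is included.
  A path is a \<^const>\<open>vpath\<close>, that is, a non-empty list of distinct vertices in which consecutive
  vertices are adjacent.
\<close>

text \<open>The values of a labeling outside of \<^term>\<open>verts G\<close> are irrelevant.\<close>

definition is_ranking :: "('a,'b) pre_digraph \<Rightarrow> nat \<Rightarrow> ('a \<Rightarrow> nat) \<Rightarrow> bool" where
  "is_ranking G k f \<longleftrightarrow>
     (\<forall>v\<in>verts G. f v \<in> {1..k}) \<and>
     (\<forall>p. vpath p G \<longrightarrow> hd p \<noteq> last p \<longrightarrow> f (hd p) = f (last p) \<longrightarrow>
        (\<exists>w\<in>set p. f (hd p) < f w))"

definition tree_depth :: "('a,'b) pre_digraph \<Rightarrow> nat" where
  "tree_depth G = (LEAST k. \<exists>f. is_ranking G k f)"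

definition is_optimal_ranking :: "('a,'b) pre_digraph \<Rightarrow> ('a \<Rightarrow> nat) \<Rightarrow> bool" where
  "is_optimal_ranking G f \<longleftrightarrow> is_ranking G (tree_depth G) f"

definition vertex_unique :: "('a,'b) pre_digraph \<Rightarrow> nat \<Rightarrow> 'a \<Rightarrow> bool" where
  "vertex_unique G t v \<longleftrightarrow>
     v \<in> verts G \<and> (\<exists>f. is_optimal_ranking G f \<and> {u \<in> verts G. f u = t} = {v})"

definition graph_unique :: "('a,'b) pre_digraph \<Rightarrow> nat \<Rightarrow> bool" where
  "graph_unique G t \<longleftrightarrow> (\<forall>v\<in>verts G. vertex_unique G t v)"

text \<open>The minimum in the definition of \<^const>\<open>tree_depth\<close> is over a non-empty set: any injective
  labeling is a ranking.\<close>

lemma (in graph) optimal_ranking_exists: "\<exists>f. is_optimal_ranking G f"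
proof -
  obtain f where f: "bij_betw f (verts G) {1..card (verts G)}"
    using finite_same_card_bij[of "verts G" "{1..card (verts G)}"] by auto
  have "is_ranking G (card (verts G)) f"
    unfolding is_ranking_def
  proof (intro conjI ballI allI impI)
    show "f v \<in> {1..card (verts G)}" if "v \<in> verts G" for v
      using f that by (meson bij_betwE)
  next
    fix p assume p: "vpath p G" "hd p \<noteq> last p" "f (hd p) = f (last p)"
    then have "hd p \<in> verts G" "last p \<in> verts G"
      by (auto simp: vpath_def vwalk_def)
    with p f show "\<exists>w\<in>set p. f (hd p) < f w"
      by (meson bij_betw_imp_inj_on inj_onD)
  qed
  then show ?thesis
    unfolding is_optimal_ranking_def tree_depth_def
    by (rule LeastI[of "\<lambda>k. \<exists>f. is_ranking G k f", OF exI])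
qed

end

theory Submission
  imports Defs
begin

text \<open>
  Let \<open>v\<close> be the only vertex labeled \<open>t\<close> in an optimal ranking, and let \<open>t \<le> s \<le> td(G)\<close>. Lift \<open>v\<close>
  to the label \<open>s\<close> and lower each of the labels \<open>t+1, \<dots>, s\<close> by one. No two vertices other than \<open>v\<close>
  change their relative order, because the label \<open>t\<close> that the lowered vertices may enter was vacated
  by \<open>v\<close>, its sole bearer. So \<open>v\<close> is now alone with the label \<open>s\<close>, and two vertices that share a
  label now shared one before; a vertex that separated them by exceeding their label still exceeds
  it, \<open>v\<close> itself having only been lifted. No label beyond \<open>td(G)\<close> is used, and hence the new ranking
  is again optimal. The argument works for each vertex separately.
\<close>

definition lift_label :: "nat \<Rightarrow> nat \<Rightarrow> 'a \<Rightarrow> ('a \<Rightarrow> nat) \<Rightarrow> 'a \<Rightarrow> nat" where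
  "lift_label t s v f u =
     (if u = v then s else if t < f u \<and> f u \<le> s then f u - 1 else f u)"

lemma lift_label_fibre:
  assumes "{u \<in> verts G. f u = t} = {v}" and "t \<le> s"
  shows "{u \<in> verts G. lift_label t s v f u = s} = {v}"
proof -
  have v: "v \<in> verts G" using assms(1) by blast
  have "lift_label t s v f u = s \<longleftrightarrow> u = v" if "u \<in> verts G" for u
  proof -
    have at_t: "f u = t \<longleftrightarrow> u = v" using assms(1) that by blast
    show ?thesis
    proof (cases "u = v")
      case False
      with at_t have "f u \<noteq> t" by blast
      with False assms(2) show ?thesis by (auto simp: lift_label_def)
    qed (simp add: lift_label_def)
  qed
  with v show ?thesis by blast
qed

text \<open>Lowering could only merge the labels \<open>t\<close> and \<open>t+1\<close>, and no vertex other than \<open>v\<close> has the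
  label \<open>t\<close>.\<close>

lemma lift_label_eqD:
  assumes "{u \<in> verts G. f u = t} = {v}" and "t \<le> s"
    and "x \<in> verts G" "y \<in> verts G" "x \<noteq> y"
    and "lift_label t s v f x = lift_label t s v f y"
  shows "f x = f y" and "x \<noteq> v"
proof -
  have at_t: "f u = t \<longleftrightarrow> u = v" if "u \<in> verts G" for u
    using assms(1) that by blast
  have only_v: "lift_label t s v f u = s \<longleftrightarrow> u = v" if "u \<in> verts G" for u
    using lift_label_fibre[OF assms(1,2)] that by blast
  have "x = v \<longleftrightarrow> y = v"
    using only_v[OF assms(3)] only_v[OF assms(4)] assms(6) by simp
  with assms(5) show "x \<noteq> v" by blast
  with \<open>x = v \<longleftrightarrow> y = v\<close> have "y \<noteq> v" by blast
  with \<open>x \<noteq> v\<close> show "f x = f y"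
    using assms(6) at_t[OF assms(3)] at_t[OF assms(4)]
    by (auto simp: lift_label_def split: if_splits)
qed

text \<open>Only \<open>x\<close> must differ from \<open>v\<close>: lifting \<open>v\<close> may carry it past other vertices, but as the
  larger vertex \<open>w\<close> it only gains.\<close>

lemma lift_label_strict_mono:
  assumes "{u \<in> verts G. f u = t} = {v}" and "t \<le> s"
    and "x \<in> verts G" "w \<in> verts G" "x \<noteq> v" and "f x < f w"
  shows "lift_label t s v f x < lift_label t s v f w"
proof -
  have at_t: "f u = t \<longleftrightarrow> u = v" if "u \<in> verts G" for u
    using assms(1) that by blast
  show ?thesis
    using at_t[OF assms(3)] at_t[OF assms(4)] assms(2,5,6)
    by (auto simp: lift_label_def)
qed

lemma is_ranking_lift_label:
  assumes rank: "is_ranking G k f"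
    and uniq: "{u \<in> verts G. f u = t} = {v}"
    and "t \<le> s" and "s \<le> k"
  shows "is_ranking G k (lift_label t s v f)"
  unfolding is_ranking_def
proof (intro conjI ballI allI impI)
  have range: "f u \<in> {1..k}" if "u \<in> verts G" for u
    using rank that by (auto simp: is_ranking_def)
  have "v \<in> verts G" "f v = t" using uniq by blast+
  with range have "1 \<le> t" by fastforce
  then show "lift_label t s v f u \<in> {1..k}" if "u \<in> verts G" for u
    using range[OF that] \<open>t \<le> s\<close> \<open>s \<le> k\<close> by (auto simp: lift_label_def)
next
  fix p
  assume p: "vpath p G" "hd p \<noteq> last p"
    and eq: "lift_label t s v f (hd p) = lift_label t s v f (last p)"
  have verts: "set p \<subseteq> verts G" "p \<noteq> []"
    using p(1) by (auto simp: vpath_def vwalk_def)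
  then have ends: "hd p \<in> verts G" "last p \<in> verts G"
    by auto
  note old = lift_label_eqD[OF uniq \<open>t \<le> s\<close> ends p(2) eq]
  obtain w where "w \<in> set p" "f (hd p) < f w"
    using rank p old(1) unfolding is_ranking_def by blast
  then show "\<exists>w\<in>set p. lift_label t s v f (hd p) < lift_label t s v f w"
    using lift_label_strict_mono[OF uniq \<open>t \<le> s\<close> ends(1) _ old(2)] verts(1) by blast
qed

lemma vertex_unique_mono:
  assumes "vertex_unique G t v" and "t \<le> s" and "s \<le> tree_depth G"
  shows "vertex_unique G s v"
proof -
  obtain f where v: "v \<in> verts G" and rank: "is_ranking G (tree_depth G) f"
    and uniq: "{u \<in> verts G. f u = t} = {v}"
    using assms(1) unfolding vertex_unique_def is_optimal_ranking_def by blast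
  have "is_optimal_ranking G (lift_label t s v f)"
    unfolding is_optimal_ranking_def using is_ranking_lift_label[OF rank uniq assms(2,3)] .
  with v lift_label_fibre[OF uniq assms(2)] show ?thesis
    unfolding vertex_unique_def by blast
qed

theorem lemma2p3:
  fixes G :: "('a,'b) pre_digraph" and t :: nat
  assumes "graph G"
    and "t > 0"
    and "graph_unique G t"
  shows "\<forall>s. t \<le> s \<and> s \<le> tree_depth G \<longrightarrow> graph_unique G s"
proof (intro allI impI, elim conjE)
  fix s
  assume "t \<le> s" "s \<le> tree_depth G"
  with assms(3) show "graph_unique G s"
    by (simp add: graph_unique_def vertex_unique_mono[of G t])
qed

end
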